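(* Let $n\ge 2$. The number $\operatorname{TC}_n(f)$ is a homotopy invariant: if $X$ and $Y$ are path-connected spaces and $f,g\colon X\to Y$ are homotopic maps, then $\operatorname{TC}_n(f)=\operatorname{TC}_n(g)$.
   Context: All maps are continuous. Quasi-strong LS category: for a map of pairs $h\colon (B,C)\to (P,A)$, $\operatorname{qscat}(h)$ is the least non-negative integer $m$ such that $B$ can be covered by open sets $V_0,\dots,V_m$ such that for each $i$ there is a homotopy $H_i\colon V_i\times[0,1]\to P$ with $H_i(-,1)=h|_{V_i}$ and $H_i(V_i,0)\subseteq A$ (and $\infty$ if no such $m$ exists). Topological complexity of a map: let $X,Y$ be path-connected spaces, $f\colon X\to Y$ a map, and $n\ge 2$. Let $\Delta_n\colon X\to X^n$, $x\mapsto (x,\dots,x)$, be the diagonal map, and similarly for $Y$. Let $f^n=f\times\cdots\times f\colon X^n\to Y^n$ and let $\overline{f^n}\colon (X^n,\Delta_n(X))\to (Y^n,\Delta_n(Y))$ be the induced map of pairs. Then $\operatorname{TC}_n(f):=\operatorname{qscat}(\overline{f^n})$. *)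

theory Defs
  imports "HOL-Analysis.Analysis"
begin

definition map_of_pairs ::
  "'b topology \<Rightarrow> 'b set \<Rightarrow> 'p topology \<Rightarrow> 'p set \<Rightarrow> ('b \<Rightarrow> 'p) \<Rightarrow> bool" where
  "map_of_pairs B C P A h \<longleftrightarrow>
     C \<subseteq> topspace B \<and> A \<subseteq> topspace P \<and> continuous_map B P h \<and> h ` C \<subseteq> A"

definition qscat_cover ::
  "'b topology \<Rightarrow> 'p topology \<Rightarrow> 'p set \<Rightarrow> ('b \<Rightarrow> 'p) \<Rightarrow> nat \<Rightarrow> (nat \<Rightarrow> 'b set) \<Rightarrow> bool" where
  "qscat_cover B P A h m V \<longleftrightarrow>
     (\<forall>i\<le>m. openin B (V i)) \<and>
     (\<Union>i\<le>m. V i) = topspace B \<and>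
     (\<forall>i\<le>m. \<exists>H :: 'b \<times> real \<Rightarrow> 'p.
        continuous_map (prod_topology (subtopology B (V i)) (top_of_set {0..1})) P H \<and>
        (\<forall>x\<in>V i. H (x, 1) = h x) \<and>
        (\<forall>x\<in>V i. H (x, 0) \<in> A))"

(* Meant for maps of pairs h from (B, C) to (P, A). As in the usual definition, the set C does
   not enter the condition on the cover. The infimum of the empty set in enat is infinity. *)
definition qscat ::
  "'b topology \<Rightarrow> 'b set \<Rightarrow> 'p topology \<Rightarrow> 'p set \<Rightarrow> ('b \<Rightarrow> 'p) \<Rightarrow> enat" where
  "qscat B C P A h = Inf {enat m | m. \<exists>V. qscat_cover B P A h m V}"

(* Points of the n-fold power are functions on {..<n}, extended by undefined elsewhere. *)
definition power_space :: "nat \<Rightarrow> 'a topology \<Rightarrow> (nat \<Rightarrow> 'a) topology" where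
  "power_space n X = product_topology (\<lambda>i. X) {..<n}"

definition diag_map :: "nat \<Rightarrow> 'a \<Rightarrow> nat \<Rightarrow> 'a" where
  "diag_map n x = (\<lambda>i\<in>{..<n}. x)"

definition diagonal :: "nat \<Rightarrow> 'a topology \<Rightarrow> (nat \<Rightarrow> 'a) set" where
  "diagonal n X = diag_map n ` topspace X"

definition power_map :: "nat \<Rightarrow> ('a \<Rightarrow> 'b) \<Rightarrow> (nat \<Rightarrow> 'a) \<Rightarrow> nat \<Rightarrow> 'b" where
  "power_map n f x = (\<lambda>i\<in>{..<n}. f (x i))"

lemma map_of_pairs_power_map:
  assumes "continuous_map X Y f"
  shows "map_of_pairs (power_space n X) (diagonal n X) (power_space n Y) (diagonal n Y)
           (power_map n f)"
proof -
  have "continuous_map (product_topology (\<lambda>i. X) {..<n}) Y (\<lambda>x. f (x k))" if "k < n" for k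
    using continuous_map_compose[OF continuous_map_product_projection[of k "{..<n}" "\<lambda>i. X"] assms] that
    by (simp add: o_def)
  then have "continuous_map (power_space n X) (power_space n Y) (power_map n f)"
    by (auto simp: power_space_def power_map_def continuous_map_componentwise)
  moreover have "power_map n f ` diagonal n X \<subseteq> diagonal n Y"
  proof -
    have "power_map n f (diag_map n x) = diag_map n (f x)" for x
      by (auto simp: power_map_def diag_map_def)
    then show ?thesis
      using continuous_map_image_subset_topspace[OF assms] by (auto simp: diagonal_def)
  qed
  ultimately show ?thesis
    by (auto simp: map_of_pairs_def diagonal_def diag_map_def power_space_def)
qed

definition TC :: "nat \<Rightarrow> 'a topology \<Rightarrow> 'b topology \<Rightarrow> ('a \<Rightarrow> 'b) \<Rightarrow> enat" where
  "TC n X Y f =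
     qscat (power_space n X) (diagonal n X) (power_space n Y) (diagonal n Y) (power_map n f)"

end

theory Submission
  imports Defs
begin

text \<open>If f and g are homotopic, so are their n-fold powers
  (\<open>homotopic_power_map\<close>). It then suffices that \<open>qscat\<close> depends only on
  the homotopy class of the map (\<open>qscat_homotopic\<close>). The same open cover serves both
  maps (\<open>qscat_cover_homotopic\<close>): on each member, follow the given homotopy, from a map
  into A to h, by the restriction of a homotopy from h to k. Only the end at time 1 changes, so the
  time 0 map still lands in A.\<close>

text \<open>The witness k is the time 0 slice of H; the two sides otherwise differ only by swapping
  the factors of the product. The point of the translation is that transitivity of
  \<open>homotopic_with\<close> replaces explicit concatenation of homotopies.\<close>

lemma homotopy_into_iff_homotopic_with:
  fixes h :: "'b \<Rightarrow> 'p"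
  assumes "S \<subseteq> topspace B"
  shows "(\<exists>H :: 'b \<times> real \<Rightarrow> 'p.
        continuous_map (prod_topology (subtopology B S) (top_of_set {0..1})) P H \<and>
        (\<forall>x\<in>S. H (x, 1) = h x) \<and> (\<forall>x\<in>S. H (x, 0) \<in> A)) \<longleftrightarrow>
    (\<exists>k. homotopic_with (\<lambda>_. True) (subtopology B S) P k h \<and> k ` S \<subseteq> A)"
  (is "?L \<longleftrightarrow> ?R")
proof -
  have top: "topspace (subtopology B S) = S"
    using assms by auto
  \<comment> \<open>The definition of \<open>homotopic_with\<close> prescribes the end maps on the
    whole type. As the property is constantly true, agreement on S is enough.\<close>
  have hw: "homotopic_with (\<lambda>_. True) (subtopology B S) P k h \<longleftrightarrow>
      (\<exists>G. continuous_map (prod_topology (top_of_set {0..1::real}) (subtopology B S)) P G \<and>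
        (\<forall>x\<in>S. G (0, x) = k x) \<and> (\<forall>x\<in>S. G (1, x) = h x))" for k
    by (subst homotopic_with) (simp_all only: top simp_thms ball_triv)
  show ?thesis
  proof
    assume ?L
    then obtain H where "continuous_map (prod_topology (subtopology B S) (top_of_set {0..1::real})) P H"
      and H: "\<forall>x\<in>S. H (x, 1) = h x" "\<forall>x\<in>S. H (x, 0) \<in> A" by blast
    then have "continuous_map (prod_topology (top_of_set {0..1::real}) (subtopology B S)) P
        (H \<circ> (\<lambda>(t, x). (x, t)))"
      by (intro continuous_map_compose[OF homeomorphic_imp_continuous_map[OF homeomorphic_map_swap]])
    then have "homotopic_with (\<lambda>_. True) (subtopology B S) P (\<lambda>x. H (x, 0)) h"
      using H unfolding hw by (intro exI[of _ "H \<circ> (\<lambda>(t, x). (x, t))"]) auto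
    with H show ?R by blast
  next
    assume ?R
    then obtain k G where "continuous_map (prod_topology (top_of_set {0..1::real}) (subtopology B S)) P G"
      and G: "\<forall>x\<in>S. G (0, x) = k x" "\<forall>x\<in>S. G (1, x) = h x" "k ` S \<subseteq> A" unfolding hw by blast
    then have "continuous_map (prod_topology (subtopology B S) (top_of_set {0..1::real})) P
        (G \<circ> (\<lambda>(x, t). (t, x)))"
      by (intro continuous_map_compose[OF homeomorphic_imp_continuous_map[OF homeomorphic_map_swap]])
    then show ?L
      using G by (intro exI[of _ "G \<circ> (\<lambda>(x, t). (t, x))"]) auto
  qed
qed

text \<open>The cover \<open>V\<close> is kept; only the homotopies on its members are
  prolonged.\<close>

lemma qscat_cover_homotopic:
  assumes hom: "homotopic_with (\<lambda>_. True) B P h k" and cover: "qscat_cover B P A h m V"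
  shows "qscat_cover B P A k m V"
  unfolding qscat_cover_def
proof (intro conjI allI impI)
  fix i assume i: "i \<le> m"
  with cover show "openin B (V i)"
    by (simp add: qscat_cover_def)
  then have sub: "V i \<subseteq> topspace B"
    by (rule openin_subset)
  have "\<exists>H. continuous_map (prod_topology (subtopology B (V i)) (top_of_set {0..1::real})) P H \<and>
      (\<forall>x\<in>V i. H (x, 1) = h x) \<and> (\<forall>x\<in>V i. H (x, 0) \<in> A)"
    using cover i unfolding qscat_cover_def by blast
  then obtain l where l: "homotopic_with (\<lambda>_. True) (subtopology B (V i)) P l h" "l ` V i \<subseteq> A"
    unfolding homotopy_into_iff_homotopic_with[OF sub] by blast
  have "homotopic_with (\<lambda>_. True) (subtopology B (V i)) P h k"
    using hom by (rule homotopic_from_subtopology)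
  \<comment> \<open>Concatenation of l ~ h with h ~ k; the starting map l, with values in A on
    \<open>V i\<close>, stays the same.\<close>
  with l have "homotopic_with (\<lambda>_. True) (subtopology B (V i)) P l k"
    by (blast intro: homotopic_with_trans)
  with l show "\<exists>H. continuous_map (prod_topology (subtopology B (V i)) (top_of_set {0..1::real})) P H \<and>
      (\<forall>x\<in>V i. H (x, 1) = k x) \<and> (\<forall>x\<in>V i. H (x, 0) \<in> A)"
    unfolding homotopy_into_iff_homotopic_with[OF sub] by blast
qed (use cover in \<open>simp add: qscat_cover_def\<close>)

text \<open>Homotopy is symmetric, so covers transfer both ways and both infima range over the same
  set of m.\<close>

lemma qscat_homotopic:
  assumes "homotopic_with (\<lambda>_. True) B P h k"
  shows "qscat B C P A h = qscat B C P A k"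
proof -
  have "homotopic_with (\<lambda>_. True) B P k h"
    using assms by (simp add: homotopic_with_sym)
  with assms have "qscat_cover B P A h m V \<longleftrightarrow> qscat_cover B P A k m V" for m V
    by (blast intro: qscat_cover_homotopic)
  then show ?thesis
    by (simp add: qscat_def)
qed

text \<open>Run the given homotopy in all coordinates simultaneously.\<close>

lemma homotopic_power_map:
  assumes "homotopic_with (\<lambda>_. True) X Y f g"
  shows "homotopic_with (\<lambda>_. True) (power_space n X) (power_space n Y) (power_map n f) (power_map n g)"
  unfolding power_space_def power_map_def
  by (rule homotopic_with_product_topology) (use assms in auto)

theorem proposition3p3:
  fixes X :: "'a topology" and Y :: "'b topology" and f g :: "'a \<Rightarrow> 'b" and n :: nat
  assumes "n \<ge> 2"
    and "path_connected_space X" and "path_connected_space Y"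
    and "continuous_map X Y f" and "continuous_map X Y g"
    and "homotopic_with (\<lambda>_. True) X Y f g"
  shows "TC n X Y f = TC n X Y g"
  unfolding TC_def using assms(6) by (intro qscat_homotopic homotopic_power_map)

end
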